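(* Let $G=(V,E)$ be a finite connected undirected graph with real edge weights $w=(w_e)_{e\in E}$, and let $I$ be the corresponding instance of the minimum spanning tree problem. Let $H$ be the cycle graph of $G$, let $V_1,\ldots,V_\ell$ be the vertex sets of the connected components of $H$, and let $E_1,\ldots,E_\ell$ be the corresponding sets of edges of $G$, i.e. $E_i=\{e\in E\colon v_e\in V_i\}$. Then $I$ has the constant objective value property (COVP) if and only if there exist constants $\alpha_1,\ldots,\alpha_\ell$ such that $w_e=\alpha_i$ for all $e\in E_i$ and all $i\in\{1,\ldots,\ell\}$.
   Context: The cycle graph of an undirected graph $G=(V,E)$ is the undirected graph $H=(V_H,E_H)$ that has one vertex $v_e$ for each edge $e\in E$ and in which $\{v_e,v_f\}\in E_H$ if and only if $e$ and $f$ are distinct edges lying on a common simple cycle of $G$. The feasible solutions of the minimum spanning tree problem are the spanning trees $T$ of $G$ (viewed as edge sets), with objective value $w(T)=\sum_{e\in T}w_e$. An instance has the constant objective value property (COVP) if all feasible solutions have the same objective value. *)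

theory Defs
  imports Complex_Main
begin

type_synonym 'a ugraph = "'a set \<times> 'a set set"

abbreviation verts :: "'a ugraph \<Rightarrow> 'a set" where
  "verts G \<equiv> fst G"

abbreviation edges :: "'a ugraph \<Rightarrow> 'a set set" where
  "edges G \<equiv> snd G"

text \<open>Undirected graphs are simple: an edge is a two-element set of vertices.\<close>

definition is_ugraph :: "'a ugraph \<Rightarrow> bool" where
  "is_ugraph G \<longleftrightarrow> (\<forall>e\<in>edges G. e \<subseteq> verts G \<and> card e = 2)"

definition adj_rel :: "'a ugraph \<Rightarrow> ('a \<times> 'a) set" where
  "adj_rel G = {(u, v). {u, v} \<in> edges G}"

definition connection_rel :: "'a ugraph \<Rightarrow> ('a \<times> 'a) set" where
  "connection_rel G = {(u, v). u \<in> verts G \<and> v \<in> verts G \<and> (u, v) \<in> (adj_rel G)\<^sup>*}"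

definition connected_ugraph :: "'a ugraph \<Rightarrow> bool" where
  "connected_ugraph G \<longleftrightarrow>
     verts G \<noteq> {} \<and> (\<forall>u\<in>verts G. \<forall>v\<in>verts G. (u, v) \<in> connection_rel G)"

definition component_vertex_sets :: "'a ugraph \<Rightarrow> 'a set set" where
  "component_vertex_sets G = verts G // connection_rel G"

text \<open>A simple cycle is given by the list of its vertices in cyclic order, without
  repeating the first vertex at the end.\<close>

definition cycle_edges :: "'a list \<Rightarrow> 'a set set" where
  "cycle_edges c = {{c ! i, c ! (Suc i mod length c)} | i. i < length c}"

definition simple_cycle :: "'a ugraph \<Rightarrow> 'a list \<Rightarrow> bool" where
  "simple_cycle G c \<longleftrightarrow>
     3 \<le> length c \<and> distinct c \<and> set c \<subseteq> verts G \<and> cycle_edges c \<subseteq> edges G"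

definition is_tree :: "'a ugraph \<Rightarrow> bool" where
  "is_tree G \<longleftrightarrow> is_ugraph G \<and> connected_ugraph G \<and> (\<nexists>c. simple_cycle G c)"

definition spanning_trees :: "'a ugraph \<Rightarrow> 'a set set set" where
  "spanning_trees G = {T. T \<subseteq> edges G \<and> is_tree (verts G, T)}"

text \<open>The vertex \<open>v\<^sub>e\<close> of the cycle graph is the edge \<open>e\<close> itself.\<close>

definition cycle_graph :: "'a ugraph \<Rightarrow> 'a set ugraph" where
  "cycle_graph G =
     (edges G,
      {{e, f} | e f. e \<in> edges G \<and> f \<in> edges G \<and> e \<noteq> f \<and>
         (\<exists>c. simple_cycle G c \<and> e \<in> cycle_edges c \<and> f \<in> cycle_edges c)})"

lemma is_ugraph_cycle_graph: "is_ugraph (cycle_graph G)"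
  unfolding is_ugraph_def cycle_graph_def card_2_iff by auto

text \<open>The constant objective value property of an instance with feasible solutions \<open>F\<close>
  and objective function \<open>obj\<close>.\<close>

definition COVP :: "'s set \<Rightarrow> ('s \<Rightarrow> real) \<Rightarrow> bool" where
  "COVP F obj \<longleftrightarrow> (\<forall>S\<in>F. \<forall>T\<in>F. obj S = obj T)"

definition MST_COVP :: "'a ugraph \<Rightarrow> ('a set \<Rightarrow> real) \<Rightarrow> bool" where
  "MST_COVP G w \<longleftrightarrow> COVP (spanning_trees G) (\<lambda>T. \<Sum>e\<in>T. w e)"

end

theory Submission
  imports Defs
begin

text \<open>
  If \<open>e\<close> and \<open>f\<close> lie on a cycle \<open>C\<close>, let \<open>X\<close> be a minimal connected spanning edge set containing \<open>C\<close>.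
  Then \<open>X - {e}\<close> and \<open>X - {f}\<close> are both spanning trees, so constant objective value forces
  \<open>w e = w f\<close>.  Conversely, for spanning trees \<open>S\<close>, \<open>T\<close> and an edge \<open>e = {a, b}\<close> in \<open>T - S\<close>, the
  path from \<open>a\<close> to \<open>b\<close> in \<open>S\<close> has an edge \<open>f\<close> leaving the part of \<open>T - {e}\<close> containing \<open>a\<close>.
  Now \<open>e\<close> and \<open>f\<close> lie on a common cycle, and replacing \<open>e\<close> by \<open>f\<close> in \<open>T\<close> gives a spanning tree that
  is closer to \<open>S\<close> and has the same weight.
\<close>

section \<open>Reachability along a set of edges\<close>

text \<open>Depending on a bare edge set only, this lets edges be deleted or inserted while the
  vertex set stays fixed.\<close>

definition reach :: "'a set set \<Rightarrow> ('a \<times> 'a) set" where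
  "reach E = {(u, v). {u, v} \<in> E}\<^sup>*"

lemma adj_rel_rtrancl: "(adj_rel G)\<^sup>* = reach (edges G)"
  by (simp add: adj_rel_def reach_def)

lemma reach_refl [simp]: "(u, u) \<in> reach E"
  by (simp add: reach_def)

lemma reach_trans: "(u, v) \<in> reach E \<Longrightarrow> (v, x) \<in> reach E \<Longrightarrow> (u, x) \<in> reach E"
  by (simp add: reach_def)

lemma reach_edge: "{u, v} \<in> E \<Longrightarrow> (u, v) \<in> reach E"
  by (auto simp: reach_def)

lemma reach_sym: "(u, v) \<in> reach E \<Longrightarrow> (v, u) \<in> reach E"
proof -
  have "sym {(u, v). {u, v} \<in> E}"
    by (auto simp: sym_def insert_commute)
  then show "(u, v) \<in> reach E \<Longrightarrow> (v, u) \<in> reach E"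
    unfolding reach_def using sym_rtrancl symD by metis
qed

lemma reach_le:
  assumes "\<And>u v. {u, v} \<in> E \<Longrightarrow> (u, v) \<in> reach F" and "(x, y) \<in> reach E"
  shows "(x, y) \<in> reach F"
  using assms(2) unfolding reach_def
proof (induction rule: rtrancl_induct)
  case base
  then show ?case by simp
next
  case (step y z)
  then have "(y, z) \<in> reach F" using assms(1) by blast
  with step show ?case using reach_trans[of x y F z] by (simp add: reach_def)
qed

lemma reach_mono: "E \<subseteq> F \<Longrightarrow> (x, y) \<in> reach E \<Longrightarrow> (x, y) \<in> reach F"
  by (rule reach_le[of E F]) (auto intro: reach_edge)

text \<open>A walk that uses \<open>{a, b}\<close> can take the detour from \<open>a\<close> to
  \<open>b\<close> instead.\<close>

lemma reach_remove_edge: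
  assumes "(a, b) \<in> reach (E - {{a, b}})" and "(x, y) \<in> reach E"
  shows "(x, y) \<in> reach (E - {{a, b}})"
proof (rule reach_le[OF _ assms(2)])
  fix u v assume uv: "{u, v} \<in> E"
  show "(u, v) \<in> reach (E - {{a, b}})"
  proof (cases "{u, v} = {a, b}")
    case True
    then show ?thesis using assms(1) reach_sym by (metis doubleton_eq_iff)
  next
    case False
    then show ?thesis using uv by (intro reach_edge) simp
  qed
qed

text \<open>Used to refute reachability: a closed set containing \<open>x\<close> but not
  \<open>y\<close> separates them.\<close>

lemma reach_closed:
  assumes "\<And>u v. {u, v} \<in> E \<Longrightarrow> u \<in> A \<Longrightarrow> v \<in> A" and "(x, y) \<in> reach E" and "x \<in> A"
  shows "y \<in> A"
  using assms(2) unfolding reach_def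
  by (induction rule: rtrancl_induct) (use assms in auto)

lemma reach_simple_path:
  assumes "(u, v) \<in> reach E"
  shows "\<exists>p. p \<noteq> [] \<and> hd p = u \<and> last p = v \<and> distinct p \<and> successively (\<lambda>x y. {x, y} \<in> E) p"
  using assms unfolding reach_def
proof (induction rule: converse_rtrancl_induct)
  case base
  show ?case by (intro exI[of _ "[v]"]) simp
next
  case (step u u')
  then obtain p where p: "p \<noteq> []" "hd p = u'" "last p = v" "distinct p"
      "successively (\<lambda>x y. {x, y} \<in> E) p"
    by blast
  show ?case
  proof (cases "u \<in> set p")
    case True
    \<comment> \<open>The new walk returns to \<open>u\<close>; dropping everything before that
      visit cuts off the loop.\<close>
    then obtain xs ys where "p = xs @ u # ys" by (meson split_list)
    then show ?thesis using p by (intro exI[of _ "u # ys"]) (auto simp: successively_append_iff)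
  next
    case False
    then show ?thesis using p step(1)
      by (intro exI[of _ "u # p"]) (auto simp: successively_Cons)
  qed
qed

section \<open>Deleting one or two edges of a cycle\<close>

text \<open>Equal edges at different positions must match crosswise, so each position is the cyclic
  successor of the other. This forces at most two positions.\<close>

lemma cycle_edge_inj:
  assumes "3 \<le> length c" "distinct c" "i < length c" "k < length c"
    and "{c ! i, c ! (Suc i mod length c)} = {c ! k, c ! (Suc k mod length c)}"
  shows "i = k"
proof (rule ccontr)
  assume "i \<noteq> k"
  let ?n = "length c"
  have lt: "m mod ?n < ?n" for m using assms(1) by (intro mod_less_divisor) linarith
  have "c ! i \<noteq> c ! k" using assms \<open>i \<noteq> k\<close> by (simp add: nth_eq_iff_index_eq)
  then have "c ! i = c ! (Suc k mod ?n)" "c ! k = c ! (Suc i mod ?n)"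
    using assms(5) by (auto simp: doubleton_eq_iff)
  then have "i = Suc k mod ?n" "k = Suc i mod ?n"
    using assms lt nth_eq_iff_index_eq by metis+
  moreover have "Suc m mod ?n = (if Suc m = ?n then 0 else Suc m)" if "m < ?n" for m
    using that by auto
  ultimately have "Suc k = ?n \<and> i = 0 \<or> i = Suc k" "Suc i = ?n \<and> k = 0 \<or> k = Suc i"
    using assms(3,4) by metis+
  then show False using assms(1) by linarith
qed

text \<open>Going around the cycle the other way joins the ends of the deleted edge.\<close>

lemma cycle_edge_reach:
  assumes c: "3 \<le> length c" "distinct c" and ab: "{a, b} \<in> cycle_edges c"
  shows "(a, b) \<in> reach (cycle_edges c - {{a, b}})"
proof -
  let ?n = "length c"
  obtain i where i: "i < ?n" "{a, b} = {c ! i, c ! (Suc i mod ?n)}"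
    using ab by (auto simp: cycle_edges_def)
  have "(c ! (Suc i mod ?n), c ! ((Suc i + m) mod ?n)) \<in> reach (cycle_edges c - {{a, b}})"
    if "m < ?n" for m
    using that
  proof (induction m)
    case 0
    then show ?case by simp
  next
    case (Suc m)
    let ?k = "(Suc i + m) mod ?n"
    have k: "?k < ?n" using i(1) by (intro mod_less_divisor) linarith
    \<comment> \<open>Starting from \<open>Suc i\<close>, position \<open>i\<close> first recurs
      after \<open>?n - 1\<close> steps, and here \<open>m < ?n - 1\<close>. So the deleted edge is
      not traversed.\<close>
    have "?k \<noteq> i"
    proof
      assume "?k = i"
      then show False
        using Suc.prems i(1) by (cases "Suc i + m < ?n") (auto simp: le_mod_geq)
    qed
    then have "{c ! ?k, c ! (Suc ?k mod ?n)} \<noteq> {a, b}"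
      using cycle_edge_inj[OF c i(1) k] i(2) by metis
    moreover have "{c ! ?k, c ! (Suc ?k mod ?n)} \<in> cycle_edges c"
      using k by (auto simp: cycle_edges_def)
    ultimately have "(c ! ?k, c ! (Suc ?k mod ?n)) \<in> reach (cycle_edges c - {{a, b}})"
      by (intro reach_edge) simp
    moreover have "Suc ?k mod ?n = (Suc i + Suc m) mod ?n" by (simp add: mod_Suc_eq)
    ultimately show ?case using reach_trans[OF Suc.IH] Suc.prems by simp
  qed
  moreover have "Suc i + (?n - 1) = i + ?n" using i(1) by simp
  then have "?n - 1 < ?n" "(Suc i + (?n - 1)) mod ?n = i" using i(1) by simp_all
  ultimately have "(c ! (Suc i mod ?n), c ! i) \<in> reach (cycle_edges c - {{a, b}})" by metis
  then show ?thesis using i(2) reach_sym by (metis doubleton_eq_iff)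
qed

text \<open>The arc \<open>A\<close> between the two deleted edges is closed under adjacency.\<close>

lemma cycle_two_edges_not_reach:
  assumes "distinct c" "{a, b} \<in> cycle_edges c" "e \<in> cycle_edges c" "e \<noteq> {a, b}"
  shows "(a, b) \<notin> reach (cycle_edges c - {e, {a, b}})"
proof -
  let ?n = "length c"
  \<comment> \<open>Ordering the positions makes the arc an index interval. Concluding for both
    edges lets the two orders be handled by swapping \<open>i\<close> and \<open>j\<close>.\<close>
  have *: "(c ! i, c ! (Suc i mod ?n)) \<notin> reach (cycle_edges c - D) \<and>
      (c ! j, c ! (Suc j mod ?n)) \<notin> reach (cycle_edges c - D)"
    if ij: "i < j" "j < ?n"
      and D: "{c ! i, c ! (Suc i mod ?n)} \<in> D" "{c ! j, c ! (Suc j mod ?n)} \<in> D" for i j D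
  proof -
    have "c \<noteq> []" using ij by auto
    define A where "A = (\<lambda>k. c ! k) ` {i<..j}"
    have inA: "c ! k \<in> A \<longleftrightarrow> i < k \<and> k \<le> j" if "k < ?n" for k
      using that ij assms(1) by (auto simp: A_def nth_eq_iff_index_eq)
    \<comment> \<open>The arc is entered only at the edge of \<open>i\<close> and left only at the
      edge of \<open>j\<close>. The wrap from the last position to 0 stays outside it.\<close>
    have succ: "c ! k \<in> A \<longleftrightarrow> c ! (Suc k mod ?n) \<in> A" if "k < ?n" "k \<noteq> i" "k \<noteq> j" for k
      using that ij inA[of k] inA[of "Suc k mod ?n"] \<open>c \<noteq> []\<close> by (cases "Suc k = ?n") auto
    have edge: "u \<in> A \<longleftrightarrow> v \<in> A" if uv: "{u, v} \<in> cycle_edges c - D" for u v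
    proof -
      obtain k where k: "k < ?n" "{u, v} = {c ! k, c ! (Suc k mod ?n)}"
        using uv by (auto simp: cycle_edges_def)
      have "k \<noteq> i" "k \<noteq> j" using uv D k(2) by auto
      from succ[OF k(1) this] show ?thesis using k(2) by (auto simp: doubleton_eq_iff)
    qed
    have closed: "x \<in> A \<longleftrightarrow> y \<in> A" if "(x, y) \<in> reach (cycle_edges c - D)" for x y
      using reach_closed[of "cycle_edges c - D" A x y]
        reach_closed[of "cycle_edges c - D" A y x] edge that reach_sym[OF that] by blast
    \<comment> \<open>Each deleted edge has exactly one end on the arc, so its ends are
      separated.\<close>
    have "c ! i \<notin> A" "c ! (Suc i mod ?n) \<in> A" "c ! j \<in> A" "c ! (Suc j mod ?n) \<notin> A"
      using ij inA[of i] inA[of "Suc i mod ?n"] inA[of j] inA[of "Suc j mod ?n"] \<open>c \<noteq> []\<close>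
      by (auto simp: mod_Suc)
    then show ?thesis using closed by blast
  qed
  obtain i where i: "i < ?n" "{a, b} = {c ! i, c ! (Suc i mod ?n)}"
    using assms(2) by (auto simp: cycle_edges_def)
  obtain j where j: "j < ?n" "e = {c ! j, c ! (Suc j mod ?n)}"
    using assms(3) by (auto simp: cycle_edges_def)
  have "i \<noteq> j" using i j assms(4) by auto
  then have "(c ! i, c ! (Suc i mod ?n)) \<notin> reach (cycle_edges c - {e, {a, b}})"
    using *[of i j "{e, {a, b}}"] *[of j i "{e, {a, b}}"] i j by (cases "i < j") auto
  then show ?thesis using i(2) reach_sym by (metis doubleton_eq_iff)
qed

section \<open>Closing paths to cycles\<close>

text \<open>Only the wrap-around index contributes a pair that is not a step of the path.\<close>

lemma cycle_edges_path:
  assumes "successively (\<lambda>x y. {x, y} \<in> E) p"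
  shows "cycle_edges p \<subseteq> insert {hd p, last p} E"
proof
  fix g assume "g \<in> cycle_edges p"
  then obtain i where i: "i < length p" "g = {p ! i, p ! (Suc i mod length p)}"
    by (auto simp: cycle_edges_def)
  show "g \<in> insert {hd p, last p} E"
  proof (cases "Suc i = length p")
    case True
    then have "p \<noteq> []" "i = length p - 1" by auto
    then show ?thesis using i(2) True by (simp add: hd_conv_nth last_conv_nth insert_commute)
  next
    case False
    then show ?thesis using i assms by (auto simp: successively_conv_nth)
  qed
qed

lemma cycle_edges_closing:
  assumes "p \<noteq> []"
  shows "{hd p, last p} \<in> cycle_edges p"
  unfolding cycle_edges_def using assms
  by (auto intro!: exI[of _ "length p - 1"] simp: hd_conv_nth last_conv_nth insert_commute)

lemma path_leaves_set:
  assumes "p \<noteq> []" "hd p \<in> A" "last p \<notin> A"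
  shows "\<exists>i. Suc i < length p \<and> p ! i \<in> A \<and> p ! Suc i \<notin> A"
proof (rule ccontr)
  assume no: "\<nexists>i. Suc i < length p \<and> p ! i \<in> A \<and> p ! Suc i \<notin> A"
  have "i < length p \<Longrightarrow> p ! i \<in> A" for i
    by (induction i) (use no assms in \<open>auto simp: hd_conv_nth\<close>)
  then show False using assms by (simp add: last_conv_nth)
qed

lemma connected_ugraph_iff:
  "connected_ugraph (V, T) \<longleftrightarrow> V \<noteq> {} \<and> (\<forall>u\<in>V. \<forall>v\<in>V. (u, v) \<in> reach T)"
  by (auto simp: connected_ugraph_def connection_rel_def adj_rel_rtrancl)

lemma simple_cycle_length: "simple_cycle G c \<Longrightarrow> 3 \<le> length c \<and> distinct c"
  by (simp add: simple_cycle_def)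

lemma simple_cycle_reach:
  assumes "simple_cycle G c" "{a, b} \<in> cycle_edges c" "cycle_edges c - {{a, b}} \<subseteq> F"
  shows "(a, b) \<in> reach F"
  by (rule reach_mono[OF assms(3)], rule cycle_edge_reach)
    (use assms in \<open>auto simp: simple_cycle_def\<close>)

lemma simple_cycle_mono:
  "simple_cycle (V, S) c \<Longrightarrow> cycle_edges c \<subseteq> T \<Longrightarrow> simple_cycle (V, T) c"
  by (simp add: simple_cycle_def)

section \<open>Spanning trees through a given cycle\<close>

locale finite_connected_ugraph =
  fixes V :: "'a set" and E :: "'a set set"
  assumes ugraph: "is_ugraph (V, E)"
    and finV: "finite V"
    and connected: "connected_ugraph (V, E)"
begin

lemma finite_edges: "finite E"
  using finV ugraph by (auto simp: is_ugraph_def intro: finite_subset[of E "Pow V"])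

lemma edgeE:
  assumes "e \<in> E"
  obtains a b where "e = {a, b}" "a \<noteq> b" "a \<in> V" "b \<in> V"
  using assms ugraph by (fastforce simp: is_ugraph_def card_2_iff)

lemma spanning_trees_iff:
  "T \<in> spanning_trees (V, E) \<longleftrightarrow>
    T \<subseteq> E \<and> connected_ugraph (V, T) \<and> (\<nexists>c. simple_cycle (V, T) c)"
  using ugraph by (auto simp: spanning_trees_def is_tree_def is_ugraph_def)

text \<open>The rest of the cycle is a detour for \<open>g\<close>.\<close>

lemma connected_remove_cycle_edge:
  assumes "connected_ugraph (V, X)" "X \<subseteq> E" "simple_cycle (V, X) c" "g \<in> cycle_edges c"
  shows "connected_ugraph (V, X - {g})"
proof -
  have sub: "cycle_edges c \<subseteq> X" using assms(3) by (simp add: simple_cycle_def)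
  obtain a b where g: "g = {a, b}" using edgeE assms(2,4) sub by blast
  have "(a, b) \<in> reach (X - {{a, b}})"
    using simple_cycle_reach[OF assms(3)] assms(4) g sub by blast
  from reach_remove_edge[OF this] show ?thesis
    using assms(1) unfolding connected_ugraph_iff g by blast
qed

text \<open>For a minimal \<open>X\<close>, a cycle in \<open>X - {e}\<close> cannot stay inside
  \<open>c\<close>, since it misses \<open>e\<close>. It cannot leave \<open>c\<close> either, since
  an edge outside \<open>c\<close> could then be removed from \<open>X\<close>.\<close>

lemma spanning_trees_through_cycle:
  assumes c: "simple_cycle (V, E) c"
  obtains X where "X \<subseteq> E" "cycle_edges c \<subseteq> X"
    "\<And>e. e \<in> cycle_edges c \<Longrightarrow> X - {e} \<in> spanning_trees (V, E)"
proof -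
  let ?P = "\<lambda>X. X \<subseteq> E \<and> cycle_edges c \<subseteq> X \<and> connected_ugraph (V, X)"
  have "?P E" using c connected by (simp add: simple_cycle_def)
  then obtain X where X: "?P X" and min: "\<And>Y. ?P Y \<Longrightarrow> card X \<le> card Y"
    using ex_has_least_nat[of ?P E card] by blast
  have "X - {e} \<in> spanning_trees (V, E)" if e: "e \<in> cycle_edges c" for e
    unfolding spanning_trees_iff
  proof (intro conjI notI)
    show "X - {e} \<subseteq> E" using X by blast
    have cX: "simple_cycle (V, X) c" using c X simple_cycle_mono by blast
    show "connected_ugraph (V, X - {e})"
      using connected_remove_cycle_edge[OF _ _ cX e] X by blast
    assume "\<exists>d. simple_cycle (V, X - {e}) d"
    then obtain d where d: "simple_cycle (V, X - {e}) d" ..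
    then have dsub: "cycle_edges d \<subseteq> X - {e}" by (simp add: simple_cycle_def)
    have dX: "simple_cycle (V, X) d" using d dsub simple_cycle_mono by blast
    show False
    proof (cases "cycle_edges d \<subseteq> cycle_edges c")
      case True
      have "d \<noteq> []" using simple_cycle_length[OF d] by auto
      then obtain g where g: "g \<in> cycle_edges d" using cycle_edges_closing by blast
      then obtain a b where ab: "g = {a, b}" using edgeE X dsub by blast
      \<comment> \<open>The rest of \<open>d\<close> joins the ends of \<open>g\<close> within
        \<open>c\<close> while avoiding both \<open>e\<close> and \<open>g\<close>, although
        deleting two edges of \<open>c\<close> separates them.\<close>
      have "(a, b) \<in> reach (cycle_edges c - {e, {a, b}})"
        by (rule simple_cycle_reach[OF d]) (use True dsub g ab in auto)
      moreover have "e \<noteq> {a, b}" using g dsub ab by auto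
      ultimately show False
        using cycle_two_edges_not_reach[of c a b e] simple_cycle_length[OF c] True g ab e by blast
    next
      case False
      then obtain g where g: "g \<in> cycle_edges d" "g \<notin> cycle_edges c" by blast
      \<comment> \<open>Removing \<open>g\<close> preserves connectedness because \<open>g\<close>
        lies on \<open>d\<close>, and keeps all of \<open>c\<close>: this contradicts
        minimality.\<close>
      then have "?P (X - {g})" using connected_remove_cycle_edge[OF _ _ dX] X by blast
      then have "card X \<le> card (X - {g})" using min by blast
      moreover have "g \<in> X" "finite X" using g dsub X finite_edges finite_subset by blast+
      ultimately show False by (metis card_Diff1_less leD)
    qed
  qed
  then show thesis using that X by blast
qed

section \<open>Exchanging edges between spanning trees\<close>

text \<open>The cycle is the fundamental cycle of \<open>e\<close> with respect to \<open>S\<close>.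
  The edge \<open>f\<close> is one on it that crosses the cut defined by \<open>T - {e}\<close>,
  which makes the exchange a tree again.\<close>

lemma spanning_tree_exchange:
  assumes S: "S \<in> spanning_trees (V, E)" and T: "T \<in> spanning_trees (V, E)"
    and e: "e \<in> T" "e \<notin> S"
  obtains f c where "f \<in> S" "f \<notin> T" "insert f (T - {e}) \<in> spanning_trees (V, E)"
    "simple_cycle (V, E) c" "e \<in> cycle_edges c" "f \<in> cycle_edges c"
proof -
  have SE: "S \<subseteq> E" and TE: "T \<subseteq> E" using S T by (auto simp: spanning_trees_iff)
  obtain a b where ab: "e = {a, b}" "a \<noteq> b" "a \<in> V" "b \<in> V" using edgeE e TE by blast
  have acycT: "\<not> simple_cycle (V, T) c" for c using T by (simp add: spanning_trees_iff)
  have SV: "(u, v) \<in> reach S" if "u \<in> V" "v \<in> V" for u v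
    using S that by (simp add: spanning_trees_iff connected_ugraph_iff)
  \<comment> \<open>A simple path from \<open>a\<close> to \<open>b\<close> avoiding
    \<open>e\<close> closes up with \<open>e\<close>. This is used with \<open>R = T - {e}\<close>
    to contradict acyclicity of \<open>T\<close>, and with \<open>R = S\<close> to get the common
    cycle. Shorter lists fail as \<open>a \<noteq> b\<close> and
    \<open>e \<notin> R\<close>.\<close>
  have close: "simple_cycle (V, F) p \<and> e \<in> cycle_edges p"
    if p: "p \<noteq> []" "hd p = a" "last p = b" "distinct p" "successively (\<lambda>x y. {x, y} \<in> R) p"
      and R: "e \<notin> R" "insert e R \<subseteq> F" "F \<subseteq> E" for p R F
  proof -
    have "length p \<noteq> 0" "length p \<noteq> 1" "length p \<noteq> 2"
      using p R(1) ab by (auto simp: length_Suc_conv numeral_2_eq_2)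
    then have len: "3 \<le> length p" by linarith
    have pe: "cycle_edges p \<subseteq> F" using cycle_edges_path[OF p(5)] p ab R by auto
    have "set p \<subseteq> V"
    proof
      fix x assume "x \<in> set p"
      then obtain i where "i < length p" "x = p ! i" by (auto simp: in_set_conv_nth)
      then have "\<exists>g \<in> cycle_edges p. x \<in> g" by (auto simp: cycle_edges_def)
      then show "x \<in> V" using pe R(3) ugraph by (auto simp: is_ugraph_def)
    qed
    then show ?thesis
      using len pe p cycle_edges_closing[OF p(1)] ab by (auto simp: simple_cycle_def)
  qed
  define A where "A = {x. (a, x) \<in> reach (T - {e})}"
  have "b \<notin> A"
  proof
    assume "b \<in> A"
    then obtain q where "q \<noteq> []" "hd q = a" "last q = b" "distinct q"
        "successively (\<lambda>x y. {x, y} \<in> T - {e}) q"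
      using reach_simple_path[of a b "T - {e}"] by (auto simp: A_def)
    from close[OF this, of T] show False using acycT e TE by auto
  qed
  obtain p where p: "p \<noteq> []" "hd p = a" "last p = b" "distinct p"
      "successively (\<lambda>x y. {x, y} \<in> S) p"
    using reach_simple_path[OF SV[OF ab(3,4)]] by blast
  have cyc: "simple_cycle (V, E) p" "e \<in> cycle_edges p"
    using close[OF p, of E] e TE SE by auto
  obtain i where i: "Suc i < length p" "p ! i \<in> A" "p ! Suc i \<notin> A"
    using path_leaves_set[of p A] p \<open>b \<notin> A\<close> by (auto simp: A_def)
  define x where "x = p ! i"
  define y where "y = p ! Suc i"
  define f where "f = {x, y}"
  have fS: "f \<in> S" using p(5) i by (simp add: f_def x_def y_def successively_conv_nth)
  have fc: "f \<in> cycle_edges p"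
    using i(1) by (auto simp: f_def x_def y_def cycle_edges_def intro!: exI[of _ i])
  have xy: "x \<in> V" "y \<in> V" using fS SE ugraph by (fastforce simp: f_def is_ugraph_def)+
  have ax: "(a, x) \<in> reach (T - {e})" using i by (simp add: A_def x_def)
  have ay: "(a, y) \<notin> reach (T - {e})" using i by (simp add: A_def y_def)
  \<comment> \<open>This separation gives both \<open>f \<notin> T\<close> and, below, that no cycle
    passes through \<open>f\<close> in the new edge set.\<close>
  have nxy: "(x, y) \<notin> reach (T - {e})" using ax ay reach_trans by metis
  then have fT: "f \<notin> T" using reach_edge[of x y "T - {e}"] fS e by (auto simp: f_def)
  let ?T = "insert f (T - {e})"
  \<comment> \<open>Deleting \<open>e\<close> leaves at most two components, those of
    \<open>a\<close> and \<open>b\<close>: their union is closed under adjacency in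
    \<open>T\<close>, including along \<open>e\<close> itself.\<close>
  have side: "(a, z) \<in> reach (T - {e}) \<or> (b, z) \<in> reach (T - {e})" if "z \<in> V" for z
  proof -
    have "z \<in> {z. (a, z) \<in> reach (T - {e}) \<or> (b, z) \<in> reach (T - {e})}"
    proof (rule reach_closed[of T _ a])
      show "(a, z) \<in> reach T"
        using T that ab by (simp add: spanning_trees_iff connected_ugraph_iff)
      fix u v assume uv: "{u, v} \<in> T"
        "u \<in> {z. (a, z) \<in> reach (T - {e}) \<or> (b, z) \<in> reach (T - {e})}"
      show "v \<in> {z. (a, z) \<in> reach (T - {e}) \<or> (b, z) \<in> reach (T - {e})}"
      proof (cases "{u, v} = e")
        case True
        then show ?thesis using ab by (auto simp: doubleton_eq_iff)
      next
        case False
        then have "(u, v) \<in> reach (T - {e})" using uv by (intro reach_edge) simp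
        then show ?thesis using uv(2) reach_trans[of _ u "T - {e}" v] by blast
      qed
    qed simp
    then show ?thesis by simp
  qed
  have mono: "(u, v) \<in> reach ?T" if "(u, v) \<in> reach (T - {e})" for u v
    using reach_mono[OF _ that] by blast
  have "(x, y) \<in> reach ?T" by (intro reach_edge) (simp add: f_def)
  moreover have "(b, y) \<in> reach (T - {e})" using side xy ay by blast
  \<comment> \<open>The two sides are rejoined by going from \<open>a\<close> to \<open>x\<close>,
    along \<open>f\<close> to \<open>y\<close>, and on to \<open>b\<close>.\<close>
  ultimately have ab': "(a, b) \<in> reach ?T"
    using mono ax reach_sym reach_trans by metis
  have az: "(a, z) \<in> reach ?T" if "z \<in> V" for z
    using side[OF that] mono ab' reach_trans by metis
  have conn: "connected_ugraph (V, ?T)"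
    using az reach_sym reach_trans ab(3) unfolding connected_ugraph_iff by (metis empty_iff)
  have "\<not> simple_cycle (V, ?T) c" for c
  proof
    assume c: "simple_cycle (V, ?T) c"
    then have sub: "cycle_edges c \<subseteq> ?T" by (simp add: simple_cycle_def)
    show False
    \<comment> \<open>A cycle through \<open>f\<close> would join \<open>x\<close> and
      \<open>y\<close> inside \<open>T - {e}\<close>; one avoiding \<open>f\<close> would lie in
      \<open>T\<close>.\<close>
    proof (cases "f \<in> cycle_edges c")
      case True
      then have "(x, y) \<in> reach (T - {e})"
        by (intro simple_cycle_reach[OF c]) (use sub in \<open>auto simp: f_def\<close>)
      then show False using nxy by blast
    next
      case False
      then have "cycle_edges c \<subseteq> T" using sub by blast
      then show False using simple_cycle_mono[OF c] acycT by blast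
    qed
  qed
  then have "?T \<in> spanning_trees (V, E)"
    using conn fS SE TE by (auto simp: spanning_trees_iff)
  then show thesis using that fS fT cyc fc by blast
qed

section \<open>Objective values and cycles\<close>

text \<open>Each exchange moves \<open>T\<close> one edge closer to \<open>S\<close> and swaps edges
  of equal weight, so induction on \<open>card (T - S)\<close> applies.\<close>

lemma spanning_tree_weight_eq:
  fixes w :: "'a set \<Rightarrow> real"
  assumes w: "\<And>c e f. simple_cycle (V, E) c \<Longrightarrow> e \<in> cycle_edges c \<Longrightarrow> f \<in> cycle_edges c \<Longrightarrow> w e = w f"
    and S: "S \<in> spanning_trees (V, E)" and T: "T \<in> spanning_trees (V, E)"
  shows "sum w T = sum w S"
  using T
proof (induction "card (T - S)" arbitrary: T rule: less_induct)
  case less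
  have fin: "finite S" "finite T"
    using S less.prems finite_edges finite_subset by (auto simp: spanning_trees_iff)
  show ?case
  proof (cases "T \<subseteq> S")
    case True
    \<comment> \<open>Exchanging with the roles of the trees reversed would yield an edge of
      \<open>T\<close> outside \<open>S\<close>.\<close>
    have "S \<subseteq> T"
    proof
      fix e assume "e \<in> S"
      then show "e \<in> T" using spanning_tree_exchange[OF less.prems S, of e] True by blast
    qed
    then show ?thesis using True by (simp add: subset_antisym)
  next
    case False
    then obtain e where e: "e \<in> T" "e \<notin> S" by blast
    obtain f c where f: "f \<in> S" "f \<notin> T" "insert f (T - {e}) \<in> spanning_trees (V, E)"
        "simple_cycle (V, E) c" "e \<in> cycle_edges c" "f \<in> cycle_edges c"
      using spanning_tree_exchange[OF S less.prems e] by blast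
    have "insert f (T - {e}) - S = (T - S) - {e}" using f by blast
    then have "card (insert f (T - {e}) - S) < card (T - S)"
      using e fin by (simp add: card_Diff1_less del: card_Diff_insert)
    then have "sum w (insert f (T - {e})) = sum w S" using less.hyps f(3) by blast
    moreover have "sum w (insert f (T - {e})) = w f + (sum w T - w e)"
      using fin f(2) e(1) by (simp add: sum_diff1)
    ultimately show ?thesis using w[OF f(4-6)] by simp
  qed
qed

text \<open>This intermediate criterion speaks of single cycles; only the passage to components of
  the cycle graph remains after it.\<close>

lemma MST_COVP_iff_cycles:
  "MST_COVP (V, E) w \<longleftrightarrow>
    (\<forall>c. simple_cycle (V, E) c \<longrightarrow> (\<forall>e\<in>cycle_edges c. \<forall>f\<in>cycle_edges c. w e = w f))"
proof
  assume cov: "MST_COVP (V, E) w"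
  show "\<forall>c. simple_cycle (V, E) c \<longrightarrow> (\<forall>e\<in>cycle_edges c. \<forall>f\<in>cycle_edges c. w e = w f)"
  proof (intro allI impI ballI)
    fix c e f assume c: "simple_cycle (V, E) c" and ef: "e \<in> cycle_edges c" "f \<in> cycle_edges c"
    obtain X where X: "X \<subseteq> E" "cycle_edges c \<subseteq> X"
        "\<And>e. e \<in> cycle_edges c \<Longrightarrow> X - {e} \<in> spanning_trees (V, E)"
      using spanning_trees_through_cycle[OF c] by blast
    \<comment> \<open>Both sides are the weight of \<open>X\<close> less one edge, so the weights of
      the removed edges agree.\<close>
    have "sum w (X - {e}) = sum w (X - {f})"
      using cov X(3) ef by (simp add: MST_COVP_def COVP_def)
    moreover have "finite X" using X(1) finite_edges finite_subset by blast
    ultimately show "w e = w f" using ef X(2) by (auto simp: sum_diff1 subset_iff)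
  qed
next
  assume "\<forall>c. simple_cycle (V, E) c \<longrightarrow> (\<forall>e\<in>cycle_edges c. \<forall>f\<in>cycle_edges c. w e = w f)"
  then show "MST_COVP (V, E) w"
    unfolding MST_COVP_def COVP_def using spanning_tree_weight_eq by blast
qed

end

section \<open>Components of the cycle graph\<close>

lemma simple_cycle_connection_rel:
  assumes "simple_cycle G c" "e \<in> cycle_edges c" "f \<in> cycle_edges c"
  shows "(e, f) \<in> connection_rel (cycle_graph G)"
proof -
  have "e \<in> edges G" "f \<in> edges G" using assms by (auto simp: simple_cycle_def)
  then show ?thesis
    using assms
    \<comment> \<open>The cycle graph has no loops, so equal edges are related by reflexivity and
      distinct ones by adjacency.\<close>
    by (cases "e = f") (auto simp: connection_rel_def cycle_graph_def adj_rel_def)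
qed

text \<open>Adjacent vertices of the cycle graph share a cycle, so equality of weights propagates
  along a path.\<close>

lemma connection_rel_cycle_graph_const:
  assumes w: "\<And>c e f. simple_cycle G c \<Longrightarrow> e \<in> cycle_edges c \<Longrightarrow> f \<in> cycle_edges c \<Longrightarrow> w e = w f"
    and ef: "(e, f) \<in> connection_rel (cycle_graph G)"
  shows "w e = w f"
proof -
  have "(e, f) \<in> (adj_rel (cycle_graph G))\<^sup>*" using ef by (simp add: connection_rel_def)
  then show ?thesis
  proof (induction rule: rtrancl_induct)
    case (step f g)
    then have "{f, g} \<in> edges (cycle_graph G)" by (simp add: adj_rel_def)
    then have "\<exists>c. simple_cycle G c \<and> f \<in> cycle_edges c \<and> g \<in> cycle_edges c"
      by (auto simp: cycle_graph_def doubleton_eq_iff)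
    then show ?case using step w by metis
  qed simp
qed

lemma equiv_connection_rel: "equiv (verts G) (connection_rel G)"
proof (rule equivI)
  show "connection_rel G \<subseteq> verts G \<times> verts G" by (auto simp: connection_rel_def)
  show "refl_on (verts G) (connection_rel G)" by (auto simp: connection_rel_def refl_on_def)
  show "sym (connection_rel G)"
    by (auto simp: connection_rel_def sym_def adj_rel_rtrancl intro: reach_sym)
  show "trans (connection_rel G)"
    by (auto simp: connection_rel_def trans_def)
qed

theorem theorem4p2:
  fixes G :: "'a ugraph"
    and w :: "'a set \<Rightarrow> real"
    and l :: nat
    and Vc :: "nat \<Rightarrow> 'a set set"
    and Ec :: "nat \<Rightarrow> 'a set set"
  assumes "is_ugraph G"
    and "finite (verts G)"
    and "connected_ugraph G"
    and "bij_betw Vc {1..l} (component_vertex_sets (cycle_graph G))"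
    and "\<And>i. i \<in> {1..l} \<Longrightarrow> Ec i = {e \<in> edges G. e \<in> Vc i}"
  shows "MST_COVP G w \<longleftrightarrow>
    (\<exists>\<alpha> :: nat \<Rightarrow> real. \<forall>i\<in>{1..l}. \<forall>e\<in>Ec i. w e = \<alpha> i)"
proof -
  interpret finite_connected_ugraph "verts G" "edges G"
    using assms(1-3) by unfold_locales simp_all
  let ?R = "connection_rel (cycle_graph G)"
  have vH: "verts (cycle_graph G) = edges G" by (simp add: cycle_graph_def)
  have img: "Vc ` {1..l} = edges G // ?R"
    using assms(4) by (simp add: bij_betw_def component_vertex_sets_def vH)
  have eqv: "equiv (edges G) ?R" using equiv_connection_rel[of "cycle_graph G"] by (simp add: vH)
  have cov: "MST_COVP G w \<longleftrightarrow>
    (\<forall>c. simple_cycle G c \<longrightarrow> (\<forall>e\<in>cycle_edges c. \<forall>f\<in>cycle_edges c. w e = w f))"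
    using MST_COVP_iff_cycles by simp
  show ?thesis
  proof
    assume "MST_COVP G w"
    then have const: "w e = w f" if "(e, f) \<in> ?R" for e f
      using cov connection_rel_cycle_graph_const[OF _ that] by blast
    \<comment> \<open>The constant of a component is the weight of a chosen representative; the
      choice is genuine because \<open>e\<close> witnesses that \<open>Ec i\<close> is
      nonempty.\<close>
    have "w e = w (SOME f. f \<in> Ec i)" if i: "i \<in> {1..l}" and e: "e \<in> Ec i" for i e
    proof -
      have some: "(SOME f. f \<in> Ec i) \<in> Ec i" using e by (rule someI)
      have "Vc i \<in> edges G // ?R" using i img by blast
      then have "(e, SOME f. f \<in> Ec i) \<in> ?R"
        using e some assms(5)[OF i] quotient_eq_iff[OF eqv] by blast
      then show ?thesis by (rule const)
    qed
    then show "\<exists>\<alpha> :: nat \<Rightarrow> real. \<forall>i\<in>{1..l}. \<forall>e\<in>Ec i. w e = \<alpha> i"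
      by (intro exI[of _ "\<lambda>i. w (SOME f. f \<in> Ec i)"]) blast
  next
    assume "\<exists>\<alpha> :: nat \<Rightarrow> real. \<forall>i\<in>{1..l}. \<forall>e\<in>Ec i. w e = \<alpha> i"
    then obtain \<alpha> :: "nat \<Rightarrow> real" where \<alpha>: "\<forall>i\<in>{1..l}. \<forall>e\<in>Ec i. w e = \<alpha> i" ..
    have "w e = w f" if "simple_cycle G c" "e \<in> cycle_edges c" "f \<in> cycle_edges c" for c e f
    proof -
      have ef: "(e, f) \<in> ?R" using simple_cycle_connection_rel that by blast
      then have E: "e \<in> edges G" "f \<in> edges G" by (auto simp: connection_rel_def vH)
      \<comment> \<open>Since \<open>Vc\<close> enumerates all components, the class of
        \<open>e\<close> is some \<open>Vc i\<close>, and it contains \<open>f\<close> too.\<close>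
      then have "?R `` {e} \<in> Vc ` {1..l}" using img by (auto intro: quotientI)
      then obtain i where i: "i \<in> {1..l}" "Vc i = ?R `` {e}" by auto
      then have "e \<in> Ec i" "f \<in> Ec i"
        using assms(5) E ef equiv_class_self[OF eqv] by auto
      then show ?thesis using \<alpha> i(1) by simp
    qed
    then show "MST_COVP G w" using cov by blast
  qed
qed

end
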